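(* Let $G=(V(G),E(G))$ be a connected finite simple undirected graph with $|V(G)|\ge 3$, and let $U\subseteq V(G)$ with $|U|>1$. Let $\Delta^G_U$ be the $U$-nucleus complex of $G$. Then $$\tilde H_k(\Delta^G_U;\mathbb{R})\cong 0\quad\text{for every integer } k\neq |E(G)|-|V(G)|.$$
   Context: A (simple undirected) graph $G$ is a pair $(V(G),E(G))$ with $V(G)$ a finite set and $E(G)\subseteq\{S\subseteq V(G): |S|=2\}$. A vertex cover of $G$ is a set $X\subseteq V(G)$ such that $e\cap X\neq\emptyset$ for every $e\in E(G)$. A nucleus of $G$ is a connected subgraph $N\subseteq G$ (a subgraph being a pair $(V(N),E(N))$ with $V(N)\subseteq V(G)$, and $E(N)\subseteq E(G)$ consisting of edges with both endpoints in $V(N)$; not necessarily induced) such that $V(N)$ is a vertex cover of $G$. The set of nuclei of $G$ is denoted $\mathcal{N}(G)$. An abstract simplicial complex is a finite nonempty family of finite sets that is closed under taking subsets; in particular the empty set always belongs to it. A face $\sigma$ has dimension $|\sigma|-1$. For $U\subseteq V(G)$, the $U$-nucleus complex is the abstract simplicial complex (on the edges of $G$) $$\Delta^G_U=\{E(G)\setminus E(N) : N\in\mathcal{N}(G),\ U\subseteq V(N)\}.$$ $\tilde H_k(\Sigma;\mathbb{R})$ denotes the $k$-th reduced simplicial homology of an abstract simplicial complex $\Sigma$ with real coefficients, i.e. the homology of the augmented simplicial chain complex in which the empty face is a generator in degree $-1$. In particular the complex $\{\emptyset\}$ has $\tilde H_{-1}\cong\mathbb{R}$ and all other reduced homology zero.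 *)

theory Defs
  imports Complex_Main "HOL-Algebra.Elementary_Groups"
begin

section \<open>Graphs and nuclei\<close>

record 'a ugraph =
  verts :: "'a set"
  edges :: "'a set set"

definition simple_graph :: "'a ugraph \<Rightarrow> bool" where
  "simple_graph G \<longleftrightarrow> finite (verts G) \<and> edges G \<subseteq> {S. S \<subseteq> verts G \<and> card S = 2}"

definition subgraph :: "'a ugraph \<Rightarrow> 'a ugraph \<Rightarrow> bool" where
  "subgraph H G \<longleftrightarrow> simple_graph H \<and> verts H \<subseteq> verts G \<and> edges H \<subseteq> edges G"

definition adj_rel :: "'a ugraph \<Rightarrow> ('a \<times> 'a) set" where
  "adj_rel G = {(x, y). {x, y} \<in> edges G}"

text \<open>The graph without vertices is not counted as connected.\<close>

definition connected_graph :: "'a ugraph \<Rightarrow> bool" where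
  "connected_graph G \<longleftrightarrow>
     verts G \<noteq> {} \<and> (\<forall>u\<in>verts G. \<forall>v\<in>verts G. (u, v) \<in> (adj_rel G)\<^sup>*)"

definition vertex_cover :: "'a ugraph \<Rightarrow> 'a set \<Rightarrow> bool" where
  "vertex_cover G X \<longleftrightarrow> X \<subseteq> verts G \<and> (\<forall>e\<in>edges G. e \<inter> X \<noteq> {})"

definition nuclei :: "'a ugraph \<Rightarrow> 'a ugraph set" where
  "nuclei G = {N. subgraph N G \<and> connected_graph N \<and> vertex_cover G (verts N)}"

definition nucleus_complex :: "'a ugraph \<Rightarrow> 'a set \<Rightarrow> 'a set set set" where
  "nucleus_complex G U = {edges G - edges N | N. N \<in> nuclei G \<and> U \<subseteq> verts N}"


section \<open>Reduced simplicial homology with real coefficients\<close>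

text \<open>
  A finite abstract simplicial complex is given by its set \<open>K\<close> of faces, including the empty face.
  A \<open>k\<close>-chain is the family of its coefficients, extended by \<open>0\<close> to sets that are not
  \<open>k\<close>-dimensional faces. The degree \<open>k\<close> is an integer: the empty face spans degree \<open>-1\<close>, and
  all chains of degree below \<open>-1\<close> are \<open>0\<close>.
\<close>

definition chains :: "'b set set \<Rightarrow> int \<Rightarrow> ('b set \<Rightarrow> real) set" where
  "chains K k = {c. \<forall>\<sigma>. c \<sigma> \<noteq> 0 \<longrightarrow> \<sigma> \<in> K \<and> int (card \<sigma>) - 1 = k}"

text \<open>
  Faces are oriented by a linear order \<open>r\<close> on the vertices of the complex, so that
  \<open>\<partial>[v\<^sub>0 < \<dots> < v\<^sub>k] = (\<Sum>i\<le>k. (-1)^i [v\<^sub>0, \<dots>, v\<^sub>i\<^sub>-\<^sub>1, v\<^sub>i\<^sub>+\<^sub>1, \<dots>, v\<^sub>k])\<close>;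
  \<open>face_pos r \<sigma> v\<close> is the index \<open>i\<close> of \<open>v\<close> in \<open>\<sigma>\<close>, and \<open>boundary\<close> is the linear extension
  of this formula. In degree \<open>0\<close> it is the augmentation.
\<close>

definition face_pos :: "'b rel \<Rightarrow> 'b set \<Rightarrow> 'b \<Rightarrow> nat" where
  "face_pos r \<sigma> v = card {w \<in> \<sigma>. w \<noteq> v \<and> (w, v) \<in> r}"

definition boundary :: "'b rel \<Rightarrow> 'b set set \<Rightarrow> ('b set \<Rightarrow> real) \<Rightarrow> 'b set \<Rightarrow> real" where
  "boundary r K c =
     (\<lambda>\<tau>. \<Sum>\<sigma>\<in>K. c \<sigma> * (\<Sum>v\<in>\<sigma>. if \<tau> = \<sigma> - {v} then (-1) ^ face_pos r \<sigma> v else 0))"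

definition cycles :: "'b rel \<Rightarrow> 'b set set \<Rightarrow> int \<Rightarrow> ('b set \<Rightarrow> real) set" where
  "cycles r K k = {c \<in> chains K k. boundary r K c = (\<lambda>\<tau>. 0)}"

definition boundaries :: "'b rel \<Rightarrow> 'b set set \<Rightarrow> int \<Rightarrow> ('b set \<Rightarrow> real) set" where
  "boundaries r K k = boundary r K ` chains K (k + 1)"

definition cycle_group :: "'b rel \<Rightarrow> 'b set set \<Rightarrow> int \<Rightarrow> ('b set \<Rightarrow> real) monoid" where
  "cycle_group r K k =
     \<lparr>carrier = cycles r K k, mult = (\<lambda>c d \<sigma>. c \<sigma> + d \<sigma>), one = (\<lambda>\<sigma>. 0)\<rparr>"

text \<open>
  Only the additive group of the homology vector space is recorded. The vector space is zero
  exactly when this group is trivial.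
\<close>

definition reduced_homology ::
    "'b rel \<Rightarrow> 'b set set \<Rightarrow> int \<Rightarrow> ('b set \<Rightarrow> real) set monoid" where
  "reduced_homology r K k = cycle_group r K k Mod boundaries r K k"

end

theory Submission imports Defs
begin

text \<open>
  A nucleus containing \<open>U\<close> is determined by its edge set as soon as \<open>U\<close> is nonempty: if
  \<open>u \<in> U\<close>, its vertices are those that \<open>u\<close> reaches along its edges. Hence the nucleus
  complex is an instance of the following family, which is closed under deletion and contraction
  of edges. Take a set \<open>S\<close> of vertices, to be thought of as one root vertex obtained by contraction,
  and let the faces be the sets of edges \<open>\<sigma> \<subseteq> E\<close> such that the vertices reachable from \<open>S\<close> without
  \<open>\<sigma>\<close> contain \<open>U\<close> and cover all edges of \<open>E\<close>. If every vertex of \<open>V\<close> is reachable from \<open>S\<close>, the only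
  degree that can carry homology is \<open>|E| - |V - S| - 1\<close>, which for \<open>S = {u}\<close> is \<open>|E| - |V|\<close>.

  Pick an edge \<open>e\<close> with an end \<open>x\<close> in \<open>S\<close>. If its other end \<open>y\<close> is in \<open>S\<close> as well, then \<open>e\<close> is a loop
  at the root, its removal never matters, and the complex is a cone with apex \<open>e\<close>, hence has no
  homology (\<open>cone_homology_vanishes\<close>). Otherwise the faces without \<open>e\<close> form the complex
  of the graph in which \<open>e\<close> is contracted, that is, \<open>y\<close> joins \<open>S\<close> (\<open>rooted_complex_deletion\<close>). The link
  of \<open>e\<close> is the complex of the graph without \<open>e\<close> (\<open>rooted_complex_link\<close>), since \<open>e\<close> itself is always
  covered by \<open>x\<close>. If \<open>d\<close> is the critical degree of the whole complex, those of
  deletion and link are \<open>d\<close> and \<open>d - 1\<close>, so induction on the number of edges and the long exact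
  sequence of deletion and link give the claim (\<open>homology_vanishes_if_link_deletion\<close>). If \<open>e\<close> is a bridge,
  its removal disconnects the graph and the induction does not reach the link. But then
  the link is either void, so that the complex equals the deletion, or \<open>y\<close> is a leaf
  outside \<open>U\<close> and the complex is again a cone with apex \<open>e\<close> (\<open>rooted_complex_cone_if_leaf\<close>).
\<close>

section \<open>Chains on a finite ordered vertex set\<close>

lemma chains_minus: "c \<in> chains K k \<Longrightarrow> (\<lambda>\<sigma>. - c \<sigma>) \<in> chains K k"
  by (simp add: chains_def)

lemma chains_add:
  assumes "c \<in> chains K k" "d \<in> chains K k"
  shows "(\<lambda>\<sigma>. c \<sigma> + d \<sigma>) \<in> chains K k"
proof -
  have "c \<sigma> \<noteq> 0 \<or> d \<sigma> \<noteq> 0" if "c \<sigma> + d \<sigma> \<noteq> 0" for \<sigma>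
    using that by auto
  then show ?thesis
    using assms unfolding chains_def by blast
qed

lemma chains_diff: "c \<in> chains K k \<Longrightarrow> d \<in> chains K k \<Longrightarrow> (\<lambda>\<sigma>. c \<sigma> - d \<sigma>) \<in> chains K k"
  using chains_add[OF _ chains_minus] by fastforce

definition simplex_link :: "'b set set \<Rightarrow> 'b \<Rightarrow> 'b set set" where
  "simplex_link K e = {\<sigma>. e \<notin> \<sigma> \<and> insert e \<sigma> \<in> K}"

definition simplex_deletion :: "'b set set \<Rightarrow> 'b \<Rightarrow> 'b set set" where
  "simplex_deletion K e = {\<sigma> \<in> K. e \<notin> \<sigma>}"

locale ordered_ground_set =
  fixes E :: "'b set" and r :: "'b rel"
  assumes finite_ground: "finite E"
    and linear: "linear_order_on E r"
begin

definition face_sign :: "'b set \<Rightarrow> 'b \<Rightarrow> real" where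
  "face_sign \<sigma> v = (-1) ^ face_pos r \<sigma> v"

lemma face_sign_square [simp]: "face_sign \<sigma> v * face_sign \<sigma> v = 1"
  by (simp add: face_sign_def flip: power_add)

lemma face_sign_square_left [simp]: "face_sign \<sigma> v * (face_sign \<sigma> v * a) = a"
  by (simp flip: mult.assoc)

lemma face_sign_nonzero [simp]: "face_sign \<sigma> v \<noteq> 0"
  by (simp add: face_sign_def)

text \<open>
  Removing the smaller of two vertices shifts the position of the larger one by one; removing the
  larger one leaves the position of the smaller one unchanged.
\<close>

lemma face_sign_swap:
  assumes "v \<in> \<sigma>" "w \<in> \<sigma>" "v \<noteq> w" "v \<in> E" "w \<in> E"
  shows "face_sign \<sigma> v * face_sign (\<sigma> - {v}) w = - (face_sign \<sigma> w * face_sign (\<sigma> - {w}) v)"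
proof -
  have ordered: "face_sign \<sigma> a * face_sign (\<sigma> - {a}) b = - (face_sign \<sigma> b * face_sign (\<sigma> - {b}) a)"
    if ab: "(a, b) \<in> r" "a \<in> \<sigma>" "a \<noteq> b" for a b
  proof -
    have r: "antisym r" "r \<subseteq> E \<times> E"
      using linear by (auto simp: order_on_defs)
    let ?B = "{w \<in> \<sigma>. w \<noteq> b \<and> (w, b) \<in> r}"
    have "?B \<subseteq> E"
      using r(2) by auto
    then have "finite ?B"
      using finite_ground by (rule finite_subset)
    moreover have "a \<in> ?B"
      using ab by auto
    ultimately have "card ?B = Suc (card (?B - {a}))"
      by (rule card.remove)
    moreover have "{w \<in> \<sigma> - {a}. w \<noteq> b \<and> (w, b) \<in> r} = ?B - {a}"
      by auto
    ultimately have b: "face_pos r \<sigma> b = Suc (face_pos r (\<sigma> - {a}) b)"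
      by (simp only: face_pos_def)
    have "{w \<in> \<sigma> - {b}. w \<noteq> a \<and> (w, a) \<in> r} = {w \<in> \<sigma>. w \<noteq> a \<and> (w, a) \<in> r}"
      using r(1) ab by (auto dest: antisymD)
    then have "face_pos r (\<sigma> - {b}) a = face_pos r \<sigma> a"
      unfolding face_pos_def by simp
    with b show ?thesis
      by (simp add: face_sign_def)
  qed
  have "(v, w) \<in> r \<or> (w, v) \<in> r"
    using linear assms by (auto simp: order_on_defs total_on_def)
  then show ?thesis
    using ordered[of v w] ordered[of w v] assms by auto
qed

text \<open>
  The boundary operator without reference to the complex: a chain that is supported on a complex has
  the same boundary in every larger complex on \<open>E\<close>, so deletion, link and complex can share one operator.
\<close>

definition bd :: "('b set \<Rightarrow> real) \<Rightarrow> 'b set \<Rightarrow> real" where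
  "bd c \<tau> = (\<Sum>v\<in>E - \<tau>. face_sign (insert v \<tau>) v * c (insert v \<tau>))"

lemma finite_face: "K \<subseteq> Pow E \<Longrightarrow> \<sigma> \<in> K \<Longrightarrow> finite \<sigma>"
  by (rule finite_subset[OF _ finite_ground]) auto

lemma boundary_eq_bd:
  assumes K: "K \<subseteq> Pow E" and c: "\<And>\<sigma>. c \<sigma> \<noteq> 0 \<Longrightarrow> \<sigma> \<in> K"
  shows "boundary r K c = bd c"
proof
  fix \<tau>
  have "boundary r K c \<tau> =
      (\<Sum>\<sigma>\<in>Pow E. c \<sigma> * (\<Sum>v\<in>\<sigma>. if \<tau> = \<sigma> - {v} then face_sign \<sigma> v else 0))"
    unfolding boundary_def face_sign_def
    by (rule sum.mono_neutral_left) (use K c finite_ground in auto)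
  also have "\<dots> = (\<Sum>\<sigma>\<in>Pow E. \<Sum>v\<in>E. if v \<in> \<sigma> \<and> \<tau> = \<sigma> - {v} then face_sign \<sigma> v * c \<sigma> else 0)"
  proof (rule sum.cong)
    fix \<sigma> assume "\<sigma> \<in> Pow E"
    then have "(\<Sum>v\<in>\<sigma>. if \<tau> = \<sigma> - {v} then face_sign \<sigma> v * c \<sigma> else 0) =
        (\<Sum>v\<in>E. if v \<in> \<sigma> \<and> \<tau> = \<sigma> - {v} then face_sign \<sigma> v * c \<sigma> else 0)"
      by (intro sum.mono_neutral_cong_left) (use finite_ground in auto)
    then show "c \<sigma> * (\<Sum>v\<in>\<sigma>. if \<tau> = \<sigma> - {v} then face_sign \<sigma> v else 0) =
        (\<Sum>v\<in>E. if v \<in> \<sigma> \<and> \<tau> = \<sigma> - {v} then face_sign \<sigma> v * c \<sigma> else 0)"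
      by (simp add: sum_distrib_left if_distrib[where f = "\<lambda>x. c \<sigma> * x"] mult.commute cong: if_cong)
  qed simp
  also have "\<dots> = (\<Sum>v\<in>E. \<Sum>\<sigma>\<in>Pow E. if v \<in> \<sigma> \<and> \<tau> = \<sigma> - {v} then face_sign \<sigma> v * c \<sigma> else 0)"
    by (rule sum.swap)
  also have "\<dots> = (\<Sum>v\<in>E. if v \<notin> \<tau> then face_sign (insert v \<tau>) v * c (insert v \<tau>) else 0)"
  proof (rule sum.cong)
    fix v assume "v \<in> E"
    have "v \<in> \<sigma> \<and> \<tau> = \<sigma> - {v} \<longleftrightarrow> \<sigma> = insert v \<tau> \<and> v \<notin> \<tau>" for \<sigma>
      by (metis Diff_iff Diff_insert_absorb insert_Diff insertI1)
    then have "(\<Sum>\<sigma>\<in>Pow E. if v \<in> \<sigma> \<and> \<tau> = \<sigma> - {v} then face_sign \<sigma> v * c \<sigma> else 0) =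
        (\<Sum>\<sigma>\<in>Pow E. if \<sigma> = insert v \<tau> then
           (if v \<notin> \<tau> then face_sign (insert v \<tau>) v * c (insert v \<tau>) else 0) else 0)"
      by (intro sum.cong) simp_all
    also have "\<dots> = (if v \<notin> \<tau> then face_sign (insert v \<tau>) v * c (insert v \<tau>) else 0)"
      using finite_ground K c[of "insert v \<tau>"] by (auto simp: sum.delta)
    finally show "(\<Sum>\<sigma>\<in>Pow E. if v \<in> \<sigma> \<and> \<tau> = \<sigma> - {v} then face_sign \<sigma> v * c \<sigma> else 0) =
        (if v \<notin> \<tau> then face_sign (insert v \<tau>) v * c (insert v \<tau>) else 0)" .
  qed simp
  also have "\<dots> = bd c \<tau>"
    unfolding bd_def by (intro sum.mono_neutral_cong_right) (use finite_ground in auto)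
  finally show "boundary r K c \<tau> = bd c \<tau>" .
qed

lemma bd_add: "bd (\<lambda>\<sigma>. c \<sigma> + d \<sigma>) \<tau> = bd c \<tau> + bd d \<tau>"
  by (simp add: bd_def distrib_left sum.distrib)

lemma bd_minus: "bd (\<lambda>\<sigma>. - c \<sigma>) \<tau> = - bd c \<tau>"
  by (simp add: bd_def sum_negf)

lemma bd_diff: "bd (\<lambda>\<sigma>. c \<sigma> - d \<sigma>) \<tau> = bd c \<tau> - bd d \<tau>"
  by (simp add: bd_def right_diff_distrib sum_subtractf)

lemma bd_zero [simp]: "bd (\<lambda>\<sigma>. 0) \<tau> = 0"
  by (simp add: bd_def)

lemma bd_eq_0_if_contains:
  assumes "e \<in> \<tau>" "\<And>\<sigma>. e \<in> \<sigma> \<Longrightarrow> c \<sigma> = 0"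
  shows "bd c \<tau> = 0"
  using assms by (auto simp: bd_def intro!: sum.neutral)

text \<open>
  The sets in which \<open>\<tau>\<close> has codimension two are \<open>\<tau> \<union> {v, w}\<close>. Each is counted for \<open>(v, w)\<close> and for \<open>(w, v)\<close>, with
  opposite signs, so the double sum equals its own negative.
\<close>

lemma bd_bd: "bd (bd c) \<tau> = 0"
proof -
  define f where "f v w = (if v \<notin> \<tau> \<and> w \<notin> \<tau> \<and> v \<noteq> w
      then face_sign (insert v \<tau>) v * (face_sign (insert w (insert v \<tau>)) w * c (insert w (insert v \<tau>)))
      else 0)" for v w
  have "bd (bd c) \<tau> = (\<Sum>v\<in>E - \<tau>. \<Sum>w\<in>E - insert v \<tau>. f v w)"
    unfolding bd_def sum_distrib_left by (intro sum.cong) (auto simp: f_def)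
  also have "\<dots> = (\<Sum>v\<in>E - \<tau>. \<Sum>w\<in>E. f v w)"
    by (intro sum.cong sum.mono_neutral_left) (use finite_ground in \<open>auto simp: f_def\<close>)
  also have "\<dots> = (\<Sum>v\<in>E. \<Sum>w\<in>E. f v w)"
    by (intro sum.mono_neutral_left) (use finite_ground in \<open>auto simp: f_def\<close>)
  finally have sum: "bd (bd c) \<tau> = (\<Sum>v\<in>E. \<Sum>w\<in>E. f v w)" .
  have anti: "f v w = - f w v" if "v \<in> E" "w \<in> E" for v w
  proof (cases "v \<notin> \<tau> \<and> w \<notin> \<tau> \<and> v \<noteq> w")
    case True
    let ?\<sigma> = "insert w (insert v \<tau>)"
    have sets: "?\<sigma> - {w} = insert v \<tau>" "?\<sigma> - {v} = insert w \<tau>" "insert v (insert w \<tau>) = ?\<sigma>" "w \<noteq> v"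
      using True by auto
    then have "face_sign ?\<sigma> w * face_sign (insert v \<tau>) v = - (face_sign ?\<sigma> v * face_sign (insert w \<tau>) w)"
      using face_sign_swap[of w ?\<sigma> v] that by simp
    then have "face_sign ?\<sigma> w * face_sign (insert v \<tau>) v * c ?\<sigma> =
        - (face_sign ?\<sigma> v * face_sign (insert w \<tau>) w) * c ?\<sigma>"
      by (rule arg_cong)
    then show ?thesis
      using True sets by (simp add: f_def algebra_simps)
  qed (auto simp: f_def)
  have "(\<Sum>v\<in>E. \<Sum>w\<in>E. f v w) = (\<Sum>v\<in>E. \<Sum>w\<in>E. - f w v)"
    by (intro sum.cong refl anti)
  also have "\<dots> = - (\<Sum>v\<in>E. \<Sum>w\<in>E. f v w)"
    by (subst sum.swap) (simp add: sum_negf)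
  finally show ?thesis
    using sum by simp
qed

text \<open>
  The join of a chain with the vertex \<open>e\<close>. The sign puts \<open>e\<close> in front of the other vertices, so that
  the usual formula \<open>\<partial>(e * c) = c - e * \<partial>c\<close> holds wherever \<open>e\<close> lies in the order.
\<close>

definition join :: "'b \<Rightarrow> ('b set \<Rightarrow> real) \<Rightarrow> 'b set \<Rightarrow> real" where
  "join e c \<sigma> = (if e \<in> \<sigma> then face_sign \<sigma> e * c (\<sigma> - {e}) else 0)"

lemma bd_join:
  assumes e: "e \<in> E" and c: "\<And>\<sigma>. e \<in> \<sigma> \<Longrightarrow> c \<sigma> = 0"
  shows "bd (join e c) \<tau> = c \<tau> - join e (bd c) \<tau>"
proof (cases "e \<in> \<tau>")
  case False
  have "bd (join e c) \<tau> = (\<Sum>v\<in>E - \<tau>. if v = e then c \<tau> else 0)"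
    unfolding bd_def by (intro sum.cong) (use False in \<open>auto simp: join_def\<close>)
  also have "\<dots> = c \<tau>"
    using False e finite_ground by (simp add: sum.delta)
  finally show ?thesis
    using False by (simp add: join_def)
next
  case True
  let ?\<rho> = "\<tau> - {e}"
  have "bd (join e c) \<tau> =
      (\<Sum>v\<in>E - \<tau>. - face_sign \<tau> e * (face_sign (insert v ?\<rho>) v * c (insert v ?\<rho>)))"
    unfolding bd_def
  proof (rule sum.cong)
    fix v assume v: "v \<in> E - \<tau>"
    let ?\<sigma> = "insert v \<tau>"
    have sets: "?\<sigma> - {v} = \<tau>" "?\<sigma> - {e} = insert v ?\<rho>" and ne: "v \<noteq> e"
      using v True by auto
    have swap: "face_sign ?\<sigma> v * face_sign \<tau> e = - (face_sign ?\<sigma> e * face_sign (insert v ?\<rho>) v)"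
      using face_sign_swap[of v ?\<sigma> e] sets ne v e True by simp
    have "face_sign ?\<sigma> v * face_sign ?\<sigma> e
        = (face_sign ?\<sigma> v * face_sign \<tau> e) * (face_sign \<tau> e * face_sign ?\<sigma> e)"
      by (simp add: mult.assoc)
    also have "\<dots> = - (face_sign \<tau> e * face_sign (insert v ?\<rho>) v)"
      unfolding swap by (simp add: algebra_simps)
    finally have sign: "face_sign ?\<sigma> v * face_sign ?\<sigma> e = - (face_sign \<tau> e * face_sign (insert v ?\<rho>) v)" .
    have "face_sign ?\<sigma> v * join e c ?\<sigma> = face_sign ?\<sigma> v * face_sign ?\<sigma> e * c (insert v ?\<rho>)"
      using True sets by (simp add: join_def)
    then show "face_sign ?\<sigma> v * join e c ?\<sigma> = - face_sign \<tau> e * (face_sign (insert v ?\<rho>) v * c (insert v ?\<rho>))"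
      unfolding sign by simp
  qed simp
  also have "\<dots> = - face_sign \<tau> e * (\<Sum>v\<in>E - \<tau>. face_sign (insert v ?\<rho>) v * c (insert v ?\<rho>))"
    by (simp add: sum_distrib_left)
  also have "(\<Sum>v\<in>E - \<tau>. face_sign (insert v ?\<rho>) v * c (insert v ?\<rho>)) = bd c ?\<rho>"
    unfolding bd_def by (intro sum.mono_neutral_left) (use finite_ground c in auto)
  finally have "bd (join e c) \<tau> = - face_sign \<tau> e * bd c ?\<rho>" .
  moreover have "join e (bd c) \<tau> = face_sign \<tau> e * bd c ?\<rho>"
    using True by (simp add: join_def)
  ultimately show ?thesis
    using True c by simp
qed

lemma join_in_chains:
  assumes "\<And>\<sigma>. c \<sigma> \<noteq> 0 \<Longrightarrow> insert e \<sigma> \<in> K \<and> finite \<sigma> \<and> int (card \<sigma>) - 1 = k"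
  shows "join e c \<in> chains K (k + 1)"
proof -
  have "\<sigma> \<in> K \<and> int (card \<sigma>) - 1 = k + 1" if nz: "join e c \<sigma> \<noteq> 0" for \<sigma>
  proof -
    have "e \<in> \<sigma>" "c (\<sigma> - {e}) \<noteq> 0"
      using nz by (auto simp: join_def split: if_splits)
    moreover from this have "card \<sigma> = Suc (card (\<sigma> - {e}))"
      using assms[of "\<sigma> - {e}"] by (metis card.remove finite_Diff2 finite.emptyI finite.insertI)
    ultimately show ?thesis
      using assms[of "\<sigma> - {e}"] by (auto simp: insert_absorb)
  qed
  then show ?thesis
    by (auto simp: chains_def)
qed


section \<open>Vanishing homology from cones, links and deletions\<close>

definition homology_vanishes :: "'b set set \<Rightarrow> int \<Rightarrow> bool" where
  "homology_vanishes K k \<longleftrightarrow>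
     (\<forall>z\<in>chains K k. bd z = (\<lambda>\<tau>. 0) \<longrightarrow> (\<exists>c\<in>chains K (k + 1). bd c = z))"

lemma homology_vanishes_void: "homology_vanishes {} k"
proof -
  have "bd (\<lambda>\<sigma>. 0) = (\<lambda>\<tau>. 0)" by auto
  then show ?thesis
    by (auto simp: homology_vanishes_def chains_def fun_eq_iff)
qed

lemma homology_vanishes_empty_face:
  assumes "k \<noteq> -1"
  shows "homology_vanishes {{}} k"
  unfolding homology_vanishes_def
proof (intro ballI impI)
  fix z :: "'b set \<Rightarrow> real" assume z: "z \<in> chains {{}} k"
  have "z \<sigma> = 0" for \<sigma>
  proof (rule ccontr)
    assume "z \<sigma> \<noteq> 0"
    then have "\<sigma> = {}" "int (card \<sigma>) - 1 = k"
      using z by (auto simp: chains_def)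
    then show False
      using assms by simp
  qed
  then have "bd (\<lambda>\<sigma>. 0) = z"
    by (intro ext) simp
  moreover have "(\<lambda>\<sigma>. 0) \<in> chains {{}} (k + 1)"
    by (simp add: chains_def)
  ultimately show "\<exists>c\<in>chains {{}} (k + 1). bd c = z"
    by blast
qed

text \<open>
  These are the two parts of the unique decomposition \<open>z = a + e * b\<close> into chains \<open>a\<close> and \<open>b\<close> on sets
  without \<open>e\<close>.
\<close>

definition without :: "'b \<Rightarrow> ('b set \<Rightarrow> real) \<Rightarrow> 'b set \<Rightarrow> real" where
  "without e z \<sigma> = (if e \<in> \<sigma> then 0 else z \<sigma>)"

definition link_part :: "'b \<Rightarrow> ('b set \<Rightarrow> real) \<Rightarrow> 'b set \<Rightarrow> real" where
  "link_part e z \<sigma> = (if e \<in> \<sigma> then 0 else face_sign (insert e \<sigma>) e * z (insert e \<sigma>))"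

lemma chain_split: "z \<sigma> = without e z \<sigma> + join e (link_part e z) \<sigma>"
  by (simp add: without_def join_def link_part_def insert_absorb)

lemma bd_split:
  assumes "e \<in> E"
  shows "bd z \<tau> = bd (without e z) \<tau> + link_part e z \<tau> - join e (bd (link_part e z)) \<tau>"
proof -
  have "z = (\<lambda>\<sigma>. without e z \<sigma> + join e (link_part e z) \<sigma>)"
    by (rule ext) (rule chain_split)
  then have "bd z \<tau> = bd (\<lambda>\<sigma>. without e z \<sigma> + join e (link_part e z) \<sigma>) \<tau>"
    by (rule arg_cong)
  also have "\<dots> = bd (without e z) \<tau> + bd (join e (link_part e z)) \<tau>"
    by (rule bd_add)
  also have "bd (join e (link_part e z)) \<tau> = link_part e z \<tau> - join e (bd (link_part e z)) \<tau>"
    by (rule bd_join[OF assms]) (simp add: link_part_def)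
  finally show ?thesis by simp
qed

text \<open>
  For a cycle \<open>z = a + e * b\<close>, the faces of \<open>\<partial>z\<close> without \<open>e\<close> give \<open>b = - \<partial>a\<close>, hence
  \<open>z = a - e * \<partial>a = \<partial>(e * a)\<close>.
\<close>

lemma cone_homology_vanishes:
  assumes K: "K \<subseteq> Pow E" and e: "e \<in> E" and cone: "\<And>\<sigma>. \<sigma> \<in> K \<Longrightarrow> insert e \<sigma> \<in> K"
  shows "homology_vanishes K k"
  unfolding homology_vanishes_def
proof (intro ballI impI)
  fix z assume z: "z \<in> chains K k" and cyc: "bd z = (\<lambda>\<tau>. 0)"
  let ?a = "without e z"
  have "link_part e z \<tau> = - bd ?a \<tau>" for \<tau>
  proof (cases "e \<in> \<tau>")
    case True
    then show ?thesis
      using bd_eq_0_if_contains[of e \<tau> ?a] by (simp add: link_part_def without_def)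
  next
    case False
    then show ?thesis
      using bd_split[OF e, of z \<tau>] cyc by (simp add: join_def)
  qed
  then have "join e (link_part e z) \<sigma> = - join e (bd ?a) \<sigma>" for \<sigma>
    by (simp add: join_def)
  then have "bd (join e ?a) = z"
    using chain_split[of z _ e] bd_join[OF e, of ?a] by (auto simp: without_def)
  moreover have "join e ?a \<in> chains K (k + 1)"
    using z cone finite_face[OF K]
    by (intro join_in_chains) (auto simp: chains_def without_def split: if_splits)
  ultimately show "\<exists>c\<in>chains K (k + 1). bd c = z" by blast
qed

text \<open>
  This is exactness of \<open>H\<^sub>k(deletion) \<rightarrow> H\<^sub>k(K) \<rightarrow> H\<^sub>k\<^sub>-\<^sub>1(link)\<close> at the middle term. If \<open>z = a + e * b\<close> is a
  cycle, so is \<open>b\<close>, say \<open>b = \<partial>c\<close> in the link. Adding \<open>\<partial>(e * c) = c - e * b\<close> moves \<open>z\<close> to the cycle \<open>a + c\<close> of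
  the deletion, which bounds there.
\<close>

lemma homology_vanishes_if_link_deletion:
  assumes K: "K \<subseteq> Pow E" and closed: "\<And>\<sigma> \<tau>. \<sigma> \<in> K \<Longrightarrow> \<tau> \<subseteq> \<sigma> \<Longrightarrow> \<tau> \<in> K" and e: "e \<in> E"
    and link: "homology_vanishes (simplex_link K e) (k - 1)"
    and deletion: "homology_vanishes (simplex_deletion K e) k"
  shows "homology_vanishes K k"
  unfolding homology_vanishes_def
proof (intro ballI impI)
  fix z assume z: "z \<in> chains K k" and cyc: "bd z = (\<lambda>\<tau>. 0)"
  let ?a = "without e z" and ?b = "link_part e z"
  have fin: "finite \<sigma>" if "\<sigma> \<in> K" for \<sigma>
    by (rule finite_face[OF K that])
  have "bd ?b \<tau> = 0" for \<tau>
  proof (cases "e \<in> \<tau>")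
    case True
    then show ?thesis
      by (rule bd_eq_0_if_contains) (simp add: link_part_def)
  next
    case False
    have "bd ?a (insert e \<tau>) = 0"
      by (rule bd_eq_0_if_contains[of e]) (auto simp: without_def)
    then have "join e (bd ?b) (insert e \<tau>) = 0"
      using bd_split[OF e, of z "insert e \<tau>"] cyc by (simp add: link_part_def)
    then show ?thesis
      using False by (simp add: join_def)
  qed
  then have "bd ?b = (\<lambda>\<tau>. 0)" by auto
  moreover have "?b \<in> chains (simplex_link K e) (k - 1)"
  proof -
    have "\<sigma> \<in> simplex_link K e \<and> int (card \<sigma>) - 1 = k - 1" if "?b \<sigma> \<noteq> 0" for \<sigma>
    proof -
      have "e \<notin> \<sigma>" and "z (insert e \<sigma>) \<noteq> 0"
        using that by (auto simp: link_part_def split: if_splits)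
      with z fin[of "insert e \<sigma>"] show ?thesis
        by (auto simp: chains_def simplex_link_def)
    qed
    then show ?thesis by (auto simp: chains_def)
  qed
  ultimately obtain c where c: "c \<in> chains (simplex_link K e) k" and bd_c: "bd c = ?b"
    using link by (force simp: homology_vanishes_def)
  have c_e: "c \<sigma> = 0" if "e \<in> \<sigma>" for \<sigma>
    using c that by (auto simp: chains_def simplex_link_def)
  have join_c: "bd (join e c) \<tau> = c \<tau> - join e ?b \<tau>" for \<tau>
    using bd_join[OF e c_e] bd_c by simp
  let ?y = "\<lambda>\<sigma>. ?a \<sigma> + c \<sigma>"
  have y: "?y = (\<lambda>\<sigma>. z \<sigma> + bd (join e c) \<sigma>)"
    using join_c chain_split[of z _ e] by auto
  have "bd ?y = (\<lambda>\<tau>. 0)"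
    unfolding y using cyc by (intro ext) (simp add: bd_add bd_bd)
  moreover have "?y \<in> chains (simplex_deletion K e) k"
  proof -
    have "\<sigma> \<in> simplex_deletion K e \<and> int (card \<sigma>) - 1 = k" if "?y \<sigma> \<noteq> 0" for \<sigma>
    proof -
      have "?a \<sigma> \<noteq> 0 \<or> c \<sigma> \<noteq> 0" using that by auto
      then show ?thesis
      proof
        assume "?a \<sigma> \<noteq> 0"
        then show ?thesis
          using z by (auto simp: chains_def simplex_deletion_def without_def split: if_splits)
      next
        assume "c \<sigma> \<noteq> 0"
        then have "insert e \<sigma> \<in> K" "e \<notin> \<sigma>" "int (card \<sigma>) - 1 = k"
          using c by (auto simp: chains_def simplex_link_def)
        moreover from this have "\<sigma> \<in> K"
          using closed by blast
        ultimately show ?thesis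
          by (simp add: simplex_deletion_def)
      qed
    qed
    then show ?thesis by (auto simp: chains_def)
  qed
  ultimately obtain d where d: "d \<in> chains (simplex_deletion K e) (k + 1)" and bd_d: "bd d = ?y"
    using deletion by (force simp: homology_vanishes_def)
  have "join e c \<in> chains K (k + 1)"
  proof (rule join_in_chains)
    fix \<sigma> assume "c \<sigma> \<noteq> 0"
    then have "insert e \<sigma> \<in> K" "int (card \<sigma>) - 1 = k"
      using c by (auto simp: chains_def simplex_link_def)
    then show "insert e \<sigma> \<in> K \<and> finite \<sigma> \<and> int (card \<sigma>) - 1 = k"
      using fin[of "insert e \<sigma>"] by simp
  qed
  moreover have "d \<in> chains K (k + 1)"
    using d by (auto simp: chains_def simplex_deletion_def)
  ultimately have "(\<lambda>\<sigma>. d \<sigma> - join e c \<sigma>) \<in> chains K (k + 1)"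
    by (intro chains_diff)
  moreover have "bd (\<lambda>\<sigma>. d \<sigma> - join e c \<sigma>) = z"
    using bd_d y by (auto simp: bd_diff)
  ultimately show "\<exists>c\<in>chains K (k + 1). bd c = z" by blast
qed

lemma reduced_homology_trivial:
  assumes K: "K \<subseteq> Pow E" and closed: "\<And>\<sigma> \<tau>. \<sigma> \<in> K \<Longrightarrow> \<tau> \<subseteq> \<sigma> \<Longrightarrow> \<tau> \<in> K"
    and vanishes: "homology_vanishes K k"
  shows "trivial_group (reduced_homology r K k)"
proof -
  have bd: "boundary r K c = bd c" if "c \<in> chains K j" for c j
    using that by (intro boundary_eq_bd[OF K]) (auto simp: chains_def)
  have cycles: "cycles r K k = {c \<in> chains K k. bd c = (\<lambda>\<tau>. 0)}"
    using bd by (auto simp: cycles_def)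
  have bd_chain: "bd c \<in> chains K k" if c: "c \<in> chains K (k + 1)" for c
  proof -
    have "\<tau> \<in> K \<and> int (card \<tau>) - 1 = k" if "bd c \<tau> \<noteq> 0" for \<tau>
    proof -
      have "\<exists>v\<in>E - \<tau>. c (insert v \<tau>) \<noteq> 0"
      proof (rule ccontr)
        assume "\<not> ?thesis"
        then have "bd c \<tau> = 0"
          by (simp add: bd_def)
        with that show False by simp
      qed
      then obtain v where v: "v \<in> E - \<tau>" "c (insert v \<tau>) \<noteq> 0"
        by blast
      then have "insert v \<tau> \<in> K" "int (card (insert v \<tau>)) = k + 2"
        using c by (auto simp: chains_def)
      moreover from this have "finite (insert v \<tau>)"
        by (intro finite_face[OF K])
      ultimately show ?thesis
        using v closed[of "insert v \<tau>" \<tau>] by auto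
    qed
    then show ?thesis by (auto simp: chains_def)
  qed
  have boundaries: "boundaries r K k = cycles r K k"
  proof -
    have "boundaries r K k = bd ` chains K (k + 1)"
      unfolding boundaries_def by (rule image_cong[OF refl bd])
    also have "\<dots> = cycles r K k"
    proof
      have "bd (bd c) = (\<lambda>\<tau>. 0)" for c
        by (rule ext) (rule bd_bd)
      then show "bd ` chains K (k + 1) \<subseteq> cycles r K k"
        using bd_chain by (auto simp: cycles)
      show "cycles r K k \<subseteq> bd ` chains K (k + 1)"
        using vanishes unfolding cycles homology_vanishes_def by blast
    qed
    finally show ?thesis .
  qed
  let ?Z = "cycle_group r K k"
  have "group ?Z"
  proof (rule groupI)
    fix x assume "x \<in> carrier ?Z"
    then show "\<exists>y\<in>carrier ?Z. y \<otimes>\<^bsub>?Z\<^esub> x = \<one>\<^bsub>?Z\<^esub>"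
      using chains_minus[of x K k] by (intro bexI[of _ "\<lambda>\<sigma>. - x \<sigma>"]) (auto simp: cycle_group_def cycles bd_minus fun_eq_iff)
  qed (auto simp: cycle_group_def cycles chains_add bd_add fun_eq_iff,
       simp add: chains_def)
  then interpret Z: group ?Z .
  have H: "reduced_homology r K k = ?Z Mod carrier ?Z"
    by (simp add: reduced_homology_def boundaries cycle_group_def)
  have "carrier ?Z #>\<^bsub>?Z\<^esub> x = carrier ?Z" if "x \<in> carrier ?Z" for x
    using Z.coset_join2[OF that Z.subgroup_self that] .
  then have "carrier (?Z Mod carrier ?Z) = {carrier ?Z}"
    using Z.one_closed by (auto simp: FactGroup_def RCOSETS_def)
  moreover have "group (?Z Mod carrier ?Z)"
    by (rule normal.factorgroup_is_group[OF Z.normal_self])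
  ultimately show ?thesis
    by (simp add: H trivial_group_def FactGroup_def)
qed

end


section \<open>Reachable vertices and the rooted complex\<close>

definition reach :: "'a set set \<Rightarrow> 'a set \<Rightarrow> 'a set" where
  "reach A S = {(x, y). {x, y} \<in> A}\<^sup>* `` S"

lemma roots_subset_reach: "S \<subseteq> reach A S"
  by (auto simp: reach_def)

lemma reach_step: "x \<in> reach A S \<Longrightarrow> {x, y} \<in> A \<Longrightarrow> y \<in> reach A S"
  by (auto simp: reach_def intro: rtrancl_into_rtrancl)

lemma reach_least:
  assumes "S \<subseteq> T" and closed: "\<And>x y. x \<in> T \<Longrightarrow> {x, y} \<in> A \<Longrightarrow> y \<in> T"
  shows "reach A S \<subseteq> T"
proof
  fix y assume "y \<in> reach A S"
  then obtain x where "(x, y) \<in> {(x, y). {x, y} \<in> A}\<^sup>*" "x \<in> T"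
    using assms(1) by (auto simp: reach_def)
  then show "y \<in> T"
    by induction (use closed in auto)
qed

lemma reach_mono:
  assumes "A \<subseteq> B"
  shows "reach A S \<subseteq> reach B S"
proof (rule reach_least[OF roots_subset_reach])
  fix x y assume "x \<in> reach B S" "{x, y} \<in> A"
  with assms show "y \<in> reach B S"
    by (intro reach_step[of x B S y]) auto
qed

lemma reach_loop:
  assumes "x \<in> S" "y \<in> S"
  shows "reach (A - {{x, y}}) S = reach A S"
proof
  show "reach A S \<subseteq> reach (A - {{x, y}}) S"
  proof (rule reach_least[OF roots_subset_reach])
    fix a b assume "a \<in> reach (A - {{x, y}}) S" "{a, b} \<in> A"
    then show "b \<in> reach (A - {{x, y}}) S"
      using reach_step[of a "A - {{x, y}}" S b] roots_subset_reach[of S "A - {{x, y}}"] assms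
      by (cases "{a, b} = {x, y}") (auto simp: doubleton_eq_iff)
  qed
qed (simp add: reach_mono)

lemma reach_contract:
  assumes "x \<in> S" "{x, y} \<in> A"
  shows "reach (A - {{x, y}}) (insert y S) = reach A S"
proof -
  have y: "y \<in> reach A S"
    using assms reach_step roots_subset_reach by (metis subsetD)
  have "reach A (insert y S) \<subseteq> reach A S"
  proof (rule reach_least)
    show "insert y S \<subseteq> reach A S"
      using y roots_subset_reach[of S A] by simp
  qed (rule reach_step)
  moreover have "reach A S \<subseteq> reach A (insert y S)"
    unfolding reach_def by auto
  ultimately show ?thesis
    using reach_loop[of x "insert y S" y A] assms(1) by auto
qed

text \<open>
  A path from the roots can use such an edge only to step onto \<open>y\<close> or from \<open>y\<close> back to the root \<open>x\<close>.
\<close>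

lemma reach_without_leaf:
  assumes leaf: "\<And>f. f \<in> A \<Longrightarrow> y \<in> f \<Longrightarrow> f = {x, y}" and x: "x \<in> S"
  shows "reach A S \<subseteq> insert y (reach (A - {{x, y}}) S)"
proof (rule reach_least)
  let ?R = "reach (A - {{x, y}}) S"
  have S: "S \<subseteq> ?R"
    by (rule roots_subset_reach)
  then show "S \<subseteq> insert y ?R"
    by blast
  fix a b assume a: "a \<in> insert y ?R" and ab: "{a, b} \<in> A"
  show "b \<in> insert y ?R"
  proof (cases "{a, b} = {x, y}")
    case True
    then show ?thesis
      using S x by (auto simp: doubleton_eq_iff)
  next
    case False
    then have "a \<noteq> y"
      using leaf[OF ab] by auto
    then show ?thesis
      using a ab False reach_step[of a "A - {{x, y}}" S b] by auto
  qed
qed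

text \<open>
  The set \<open>S\<close> stands for a single contracted root, and edges inside \<open>S\<close> for loops at it. The
  reached vertices and the complementary edges automatically form a connected graph: every edge is
  covered by a reached vertex, so the other end of a complementary edge is reached as well.
\<close>

definition rooted_complex :: "'a set set \<Rightarrow> 'a set \<Rightarrow> 'a set \<Rightarrow> 'a set set set" where
  "rooted_complex E U S =
     {\<sigma>. \<sigma> \<subseteq> E \<and> U \<subseteq> reach (E - \<sigma>) S \<and> (\<forall>f\<in>E. f \<inter> reach (E - \<sigma>) S \<noteq> {})}"

lemma rooted_complex_subset: "rooted_complex E U S \<subseteq> Pow E"
  by (auto simp: rooted_complex_def)

lemma rooted_complex_closed:
  assumes "\<sigma> \<in> rooted_complex E U S" "\<tau> \<subseteq> \<sigma>"
  shows "\<tau> \<in> rooted_complex E U S"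
proof -
  have "reach (E - \<sigma>) S \<subseteq> reach (E - \<tau>) S"
    using assms(2) by (intro reach_mono) auto
  then show ?thesis
    using assms unfolding rooted_complex_def by fast
qed

text \<open>
  A face without \<open>e\<close> leaves \<open>e\<close> in the complementary edge set, where passing along \<open>e\<close> is the same as
  having both its ends as roots. Here and for the link, \<open>e\<close> meets the root \<open>x\<close> and so imposes no
  covering condition.
\<close>

lemma rooted_complex_deletion:
  assumes "x \<in> S" and e: "{x, y} \<in> E"
  shows "simplex_deletion (rooted_complex E U S) {x, y} = rooted_complex (E - {{x, y}}) U (insert y S)"
proof -
  have reach: "reach (E - {{x, y}} - \<sigma>) (insert y S) = reach (E - \<sigma>) S" if "{x, y} \<notin> \<sigma>" for \<sigma>
  proof -
    have "E - {{x, y}} - \<sigma> = E - \<sigma> - {{x, y}}" by auto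
    then show ?thesis
      using reach_contract[of x S y "E - \<sigma>"] assms that by simp
  qed
  have cover: "{x, y} \<inter> reach A S \<noteq> {}" for A
    using assms(1) roots_subset_reach[of S A] by auto
  show ?thesis
  proof (rule Set.set_eqI)
    fix \<sigma>
    show "\<sigma> \<in> simplex_deletion (rooted_complex E U S) {x, y} \<longleftrightarrow>
        \<sigma> \<in> rooted_complex (E - {{x, y}}) U (insert y S)"
    proof (cases "{x, y} \<in> \<sigma>")
      case True
      then show ?thesis
        by (auto simp: simplex_deletion_def rooted_complex_def)
    next
      case False
      then show ?thesis
        using reach[OF False] cover[of "E - \<sigma>"]
        by (auto simp: simplex_deletion_def rooted_complex_def)
    qed
  qed
qed

lemma rooted_complex_link:
  assumes "x \<in> S" and e: "{x, y} \<in> E"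
  shows "simplex_link (rooted_complex E U S) {x, y} = rooted_complex (E - {{x, y}}) U S"
proof (rule Set.set_eqI)
  fix \<sigma>
  define e where "e = {x, y}"
  let ?R = "reach (E - {e} - \<sigma>) S"
  have reach: "reach (E - insert e \<sigma>) S = ?R"
    by (rule arg_cong[where f = "\<lambda>A. reach A S"]) auto
  have "e \<in> E"
    using e by (simp add: e_def)
  then have subset: "e \<notin> \<sigma> \<and> insert e \<sigma> \<subseteq> E \<longleftrightarrow> \<sigma> \<subseteq> E - {e}"
    by blast
  have "e \<inter> ?R \<noteq> {}"
    using assms(1) roots_subset_reach[of S "E - {e} - \<sigma>"] by (auto simp: e_def)
  then have cover: "(\<forall>f\<in>E. f \<inter> ?R \<noteq> {}) \<longleftrightarrow> (\<forall>f\<in>E - {e}. f \<inter> ?R \<noteq> {})"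
    by (metis Diff_iff singletonD)
  have "\<sigma> \<in> simplex_link (rooted_complex E U S) e \<longleftrightarrow> \<sigma> \<in> rooted_complex (E - {e}) U S"
    unfolding simplex_link_def rooted_complex_def mem_Collect_eq reach cover using subset by blast
  then show "\<sigma> \<in> simplex_link (rooted_complex E U S) {x, y} \<longleftrightarrow> \<sigma> \<in> rooted_complex (E - {{x, y}}) U S"
    by (simp only: e_def)
qed

lemma rooted_complex_cone_if_loop:
  assumes "x \<in> S" "y \<in> S" "{x, y} \<in> E" "\<sigma> \<in> rooted_complex E U S"
  shows "insert {x, y} \<sigma> \<in> rooted_complex E U S"
proof -
  have "E - insert {x, y} \<sigma> = E - \<sigma> - {{x, y}}" by auto
  then have "reach (E - insert {x, y} \<sigma>) S = reach (E - \<sigma>) S"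
    using reach_loop[of x S y "E - \<sigma>"] assms by simp
  then show ?thesis
    using assms by (simp add: rooted_complex_def)
qed

lemma rooted_complex_cone_if_leaf:
  assumes x: "x \<in> S" and "y \<notin> U" and e: "{x, y} \<in> E"
    and leaf: "\<And>f. f \<in> E \<Longrightarrow> y \<in> f \<Longrightarrow> f = {x, y}"
    and \<sigma>: "\<sigma> \<in> rooted_complex E U S"
  shows "insert {x, y} \<sigma> \<in> rooted_complex E U S"
proof -
  let ?R = "reach (E - insert {x, y} \<sigma>) S"
  have "E - insert {x, y} \<sigma> = E - \<sigma> - {{x, y}}" by auto
  moreover have "reach (E - \<sigma>) S \<subseteq> insert y (reach (E - \<sigma> - {{x, y}}) S)"
    by (rule reach_without_leaf[OF leaf x]) auto
  ultimately have R: "reach (E - \<sigma>) S \<subseteq> insert y ?R"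
    by simp
  have "x \<in> ?R"
    by (rule subsetD[OF roots_subset_reach x])
  have cover: "f \<inter> ?R \<noteq> {}" if f: "f \<in> E" for f
  proof (cases "y \<in> f")
    case True
    then have "x \<in> f"
      using leaf[OF f] by simp
    with \<open>x \<in> ?R\<close> show ?thesis
      by blast
  next
    case False
    have "f \<inter> reach (E - \<sigma>) S \<noteq> {}"
      using \<sigma> f by (simp add: rooted_complex_def)
    with False R show ?thesis
      by blast
  qed
  have "insert {x, y} \<sigma> \<subseteq> E" "U \<subseteq> reach (E - \<sigma>) S"
    using \<sigma> e by (simp_all add: rooted_complex_def)
  moreover from this have "U \<subseteq> ?R"
    using R \<open>y \<notin> U\<close> by blast
  ultimately show ?thesis
    unfolding rooted_complex_def mem_Collect_eq using cover by blast
qed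


section \<open>Homology of the rooted complex\<close>

text \<open>
  Contraction enlarges the root set and both steps remove an edge, so the induction runs over \<open>E\<close> with \<open>S\<close>
  and \<open>k\<close> arbitrary. The ground set \<open>E0\<close> that carries the order stays fixed, and with it the
  boundary operator.
\<close>

theorem rooted_complex_homology:
  fixes V :: "'a set"
  assumes ground: "ordered_ground_set E0 r" and "finite V"
    and "E \<subseteq> E0" and "\<And>f. f \<in> E \<Longrightarrow> f \<subseteq> V \<and> card f = 2"
    and "S \<subseteq> V" "U \<subseteq> V" and "V \<subseteq> reach E S"
    and "k \<noteq> int (card E) - int (card (V - S)) - 1"
  shows "ordered_ground_set.homology_vanishes E0 r (rooted_complex E U S) k"
proof -
  interpret ordered_ground_set E0 r by (rule ground)
  have "finite E"
    using \<open>E \<subseteq> E0\<close> finite_ground finite_subset by auto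
  then show ?thesis
    using assms(3-5,7,8)
  proof (induction E arbitrary: S k rule: finite_psubset_induct)
    case (psubset E)
    note E = psubset.prems(1,2) and S = psubset.prems(3) and conn = psubset.prems(4)
      and k = psubset.prems(5)
    let ?K = "rooted_complex E U S"
    have K: "?K \<subseteq> Pow E0"
      using rooted_complex_subset[of E U S] E(1) by auto
    show ?case
    proof (cases "E = {}")
      case True
      then have "reach E S \<subseteq> S"
        by (intro reach_least) auto
      then have V: "V = S"
        using conn S by auto
      then have "?K = {{}}"
        using True \<open>U \<subseteq> V\<close> roots_subset_reach[of S "{}"] by (auto simp: rooted_complex_def)
      then show ?thesis
        using k V True homology_vanishes_empty_face by simp
    next
      case False
      have "\<exists>e\<in>E. e \<inter> S \<noteq> {}"
      proof (rule ccontr)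
        assume no: "\<not> ?thesis"
        then have "reach E S \<subseteq> S"
          by (intro reach_least) auto
        then have "V = S"
          using conn S by auto
        moreover obtain f where "f \<in> E" using False by auto
        ultimately show False
          using no E(2)[of f] by (auto simp: Int_absorb2)
      qed
      then obtain e x where "e \<in> E" "x \<in> e" and x: "x \<in> S" by auto
      moreover then obtain y where "e = {x, y}"
        using E(2)[of e] by (auto simp: card_2_iff)
      ultimately have e: "{x, y} \<in> E" by auto
      let ?E = "E - {{x, y}}"
      have y: "y \<in> V"
        using E(2)[OF e] by auto
      have e0: "{x, y} \<in> E0"
        using e E(1) by auto
      have E': "?E \<subset> E" "?E \<subseteq> E0" "\<And>f. f \<in> ?E \<Longrightarrow> f \<subseteq> V \<and> card f = 2"
        using e E by blast+
      have cardE: "card E = Suc (card ?E)"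
        using e psubset.hyps by (metis card.remove)
      show ?thesis
      proof (cases "y \<in> S")
        case True
        show ?thesis
          by (rule cone_homology_vanishes[OF K e0 rooted_complex_cone_if_loop[OF x True e]])
      next
        case False
        have "card (V - S) = Suc (card (V - insert y S))"
          using y False \<open>finite V\<close> by (metis Diff_iff Diff_insert card.remove finite_Diff)
        moreover have "V \<subseteq> reach ?E (insert y S)"
          using conn reach_contract[OF x e] by simp
        moreover have "insert y S \<subseteq> V"
          using y S by simp
        ultimately have deletion: "homology_vanishes (simplex_deletion ?K {x, y}) k"
          unfolding rooted_complex_deletion[OF x e]
          using k cardE by (intro psubset.IH E') simp_all
        have via_link: ?thesis if "homology_vanishes (simplex_link ?K {x, y}) (k - 1)"
          by (rule homology_vanishes_if_link_deletion[OF K rooted_complex_closed e0 that deletion])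
        show ?thesis
        proof (cases "V \<subseteq> reach ?E S")
          case True
          have "homology_vanishes (rooted_complex ?E U S) (k - 1)"
            using S True k cardE by (intro psubset.IH E') simp_all
          then show ?thesis
            by (intro via_link) (simp only: rooted_complex_link[OF x e])
        next
          case bridge: False
          show ?thesis
          proof (cases "simplex_link ?K {x, y} = {}")
            case True
            then show ?thesis
              by (intro via_link) (simp add: homology_vanishes_void)
          next
            case False
            then have empty: "{} \<in> rooted_complex ?E U S"
              unfolding rooted_complex_link[OF x e] using rooted_complex_closed by blast
            \<comment> \<open>If \<open>y\<close> were reached without \<open>e\<close>, then \<open>e\<close> would lie on a cycle through the root and not be a bridge.\<close>
            have y_unreached: "y \<notin> reach ?E S"
            proof
              assume y_reached: "y \<in> reach ?E S"
              have "reach E S \<subseteq> reach ?E S"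
              proof (rule reach_least[OF roots_subset_reach])
                fix a b assume "a \<in> reach ?E S" "{a, b} \<in> E"
                then show "b \<in> reach ?E S"
                  using reach_step[of a ?E S b] y_reached x roots_subset_reach[of S ?E]
                  by (cases "{a, b} = {x, y}") (auto simp: doubleton_eq_iff)
              qed
              with conn bridge show False by auto
            qed
            \<comment> \<open>Any other edge at \<open>y\<close> is covered without \<open>e\<close>, necessarily by its other end, and so would lead to \<open>y\<close>.\<close>
            have "f = {x, y}" if f: "f \<in> E" "y \<in> f" for f
            proof (rule ccontr)
              assume "f \<noteq> {x, y}"
              then have fE: "f \<in> ?E" using f by auto
              obtain w where w: "f = {w, y}"
                using E(2)[OF f(1)] f(2) by (auto simp: card_2_iff)
              have "\<forall>f\<in>?E. f \<inter> reach ?E S \<noteq> {}"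
                using empty by (simp add: rooted_complex_def)
              with fE have "f \<inter> reach ?E S \<noteq> {}"
                by (rule bspec[rotated])
              then have "w \<in> reach ?E S"
                using w y_unreached by auto
              then show False
                using reach_step fE y_unreached unfolding w by metis
            qed
            moreover have "y \<notin> U"
              using empty y_unreached by (auto simp: rooted_complex_def)
            ultimately show ?thesis
              using cone_homology_vanishes[OF K e0] rooted_complex_cone_if_leaf[OF x _ e] by blast
          qed
        qed
      qed
    qed
  qed
qed


section \<open>The nucleus complex as a rooted complex\<close>

lemma reach_verts_nucleus:
  assumes N: "simple_graph N" "connected_graph N" and u: "u \<in> verts N"
  shows "reach (edges N) {u} = verts N"
proof
  show "reach (edges N) {u} \<subseteq> verts N"
    using N(1) u by (intro reach_least) (auto simp: simple_graph_def)
  show "verts N \<subseteq> reach (edges N) {u}"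
    using N(2) u by (auto simp: connected_graph_def reach_def adj_rel_def)
qed

text \<open>
  A nucleus containing \<open>u\<close> has exactly the vertices that \<open>u\<close> reaches along its edges. In the other
  direction, the complement of a face is the edge set of the nucleus formed by the vertices that \<open>u\<close>
  reaches in it: each of its edges contains a reached vertex, so both its ends are reached.
\<close>

lemma nucleus_complex_eq_rooted_complex:
  assumes G: "simple_graph G" and U: "U \<subseteq> verts G" and u: "u \<in> U"
  shows "nucleus_complex G U = rooted_complex (edges G) U {u}"
proof (intro equalityI subsetI)
  fix \<sigma> assume "\<sigma> \<in> nucleus_complex G U"
  then obtain N where \<sigma>: "\<sigma> = edges G - edges N" and "N \<in> nuclei G" and UN: "U \<subseteq> verts N"
    by (auto simp: nucleus_complex_def)
  then have N: "simple_graph N" "connected_graph N" "edges N \<subseteq> edges G" "vertex_cover G (verts N)"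
    by (auto simp: nuclei_def subgraph_def)
  have "edges G - \<sigma> = edges N"
    using \<sigma> N(3) by auto
  then have "reach (edges G - \<sigma>) {u} = verts N"
    using reach_verts_nucleus[OF N(1,2)] u UN by auto
  then show "\<sigma> \<in> rooted_complex (edges G) U {u}"
    using \<sigma> UN N(4) by (auto simp: rooted_complex_def vertex_cover_def)
next
  fix \<sigma> assume \<sigma>: "\<sigma> \<in> rooted_complex (edges G) U {u}"
  let ?A = "edges G - \<sigma>"
  let ?R = "reach ?A {u}"
  let ?N = "\<lparr>verts = ?R, edges = ?A\<rparr>"
  have R: "?R \<subseteq> verts G"
    using G U u by (intro reach_least) (auto simp: simple_graph_def)
  have inside: "f \<subseteq> ?R" if f: "f \<in> ?A" for f
  proof -
    obtain a b where ab: "f = {a, b}"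
      using G f by (auto simp: simple_graph_def card_2_iff)
    moreover have "f \<inter> ?R \<noteq> {}"
      using \<sigma> f by (auto simp: rooted_complex_def)
    ultimately show ?thesis
      using reach_step[of a ?A "{u}" b] reach_step[of b ?A "{u}" a] f by (auto simp: insert_commute)
  qed
  have "simple_graph ?N"
    using G R inside finite_subset by (auto simp: simple_graph_def)
  moreover have "connected_graph ?N"
  proof -
    let ?adj = "{(x, y). {x, y} \<in> ?A}"
    have "sym (?adj\<^sup>*)"
      by (intro sym_rtrancl) (auto simp: sym_def insert_commute)
    moreover have "(u, v) \<in> ?adj\<^sup>*" if "v \<in> ?R" for v
      using that by (simp add: reach_def)
    ultimately have "(v, w) \<in> ?adj\<^sup>*" if "v \<in> ?R" "w \<in> ?R" for v w
      using that by (meson rtrancl_trans symD)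
    moreover have "u \<in> ?R"
      using roots_subset_reach[of "{u}"] by simp
    ultimately show ?thesis
      by (auto simp: connected_graph_def adj_rel_def)
  qed
  ultimately have "?N \<in> nuclei G" "U \<subseteq> verts ?N"
    using R \<sigma> by (auto simp: nuclei_def subgraph_def vertex_cover_def rooted_complex_def)
  moreover have "\<sigma> = edges G - edges ?N"
    using \<sigma> by (auto simp: rooted_complex_def)
  ultimately show "\<sigma> \<in> nucleus_complex G U"
    unfolding nucleus_complex_def by blast
qed

theorem theorem1p2:
  fixes G :: "'a ugraph" and U :: "'a set" and r :: "'a set rel"
  assumes "simple_graph G"
    and "connected_graph G"
    and "card (verts G) \<ge> 3"
    and "U \<subseteq> verts G"
    and "card U > 1"
    and "linear_order_on (edges G) r"
  shows "\<forall>k::int. k \<noteq> int (card (edges G)) - int (card (verts G)) \<longrightarrow>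
           trivial_group (reduced_homology r (nucleus_complex G U) k)"
proof (intro allI impI)
  fix k :: int assume k: "k \<noteq> int (card (edges G)) - int (card (verts G))"
  obtain u where u: "u \<in> U"
    using \<open>card U > 1\<close> by fastforce
  have finite_verts: "finite (verts G)" and edges: "edges G \<subseteq> {S. S \<subseteq> verts G \<and> card S = 2}"
    using \<open>simple_graph G\<close> by (auto simp: simple_graph_def)
  have "finite (edges G)"
    by (rule finite_subset[of _ "Pow (verts G)"]) (use finite_verts edges in auto)
  then interpret ordered_ground_set "edges G" r
    using \<open>linear_order_on (edges G) r\<close> by unfold_locales
  have "u \<in> verts G"
    using u \<open>U \<subseteq> verts G\<close> by auto
  then have "int (card (verts G - {u})) = int (card (verts G)) - 1"
    using card.remove[OF finite_verts \<open>u \<in> verts G\<close>] by simp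
  moreover have "reach (edges G) {u} = verts G"
    using reach_verts_nucleus[OF assms(1,2) \<open>u \<in> verts G\<close>] .
  ultimately have vanishes: "homology_vanishes (rooted_complex (edges G) U {u}) k"
    using k edges \<open>U \<subseteq> verts G\<close> \<open>u \<in> verts G\<close>
    by (intro rooted_complex_homology[OF ordered_ground_set_axioms finite_verts]) auto
  show "trivial_group (reduced_homology r (nucleus_complex G U) k)"
    unfolding nucleus_complex_eq_rooted_complex[OF assms(1,4) u]
    by (rule reduced_homology_trivial[OF rooted_complex_subset rooted_complex_closed vanishes])
qed

end
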